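(* For $n\ge 1$, the number of sequences $e=e_1\cdots e_n\in\mathbf{I}_n(0012)$ with $e_n=n-1$ equals $1$ if $n=1$ and $2^{n-2}$ if $n\ge 2$.
   Context: An inversion sequence of length $n$ is a sequence $e=e_1e_2\cdots e_n$ of integers with $0\le e_i\le i-1$ for each $i$. The reduction of a word is obtained by replacing each occurrence of the $k$-th smallest distinct entry by $k-1$. A sequence $e$ contains a pattern $p$ if some subsequence of $e$ (entries at increasing positions) has reduction $p$; otherwise it avoids $p$. $\mathbf{I}_n(0012)$ is the set of inversion sequences of length $n$ avoiding $0012$. *)

theory Defs
  imports Main "HOL-Library.Sublist"
begin

(* The paper's 1-based entry e_i is e ! (i - 1), so e_i <= i - 1 becomes e ! i <= i. *)
definition inversion_sequence :: "nat \<Rightarrow> nat list \<Rightarrow> bool" where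
  "inversion_sequence n e \<longleftrightarrow> length e = n \<and> (\<forall>i<n. e ! i \<le> i)"

(* The k-th smallest distinct entry has exactly k - 1 distinct entries below it. *)
definition reduction :: "nat list \<Rightarrow> nat list" where
  "reduction w = map (\<lambda>x. card {y \<in> set w. y < x}) w"

definition contains_pattern :: "nat list \<Rightarrow> nat list \<Rightarrow> bool" where
  "contains_pattern e p \<longleftrightarrow> (\<exists>s. subseq s e \<and> reduction s = p)"

definition inversion_sequences_avoiding :: "nat \<Rightarrow> nat list \<Rightarrow> nat list set" where
  "inversion_sequences_avoiding n p = {e. inversion_sequence n e \<and> \<not> contains_pattern e p}"

end

theory Submission
  imports Defs
begin

text \<open>A last entry \<open>n - 1\<close> exceeds all others, so the sequence avoids 0012 iff it avoids 001 once
  that entry is removed. An inversion sequence avoiding 001 runs \<open>0, 1, \<dots>, k - 1\<close> and then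
  continues with an entry \<open>a < k\<close>: as \<open>a\<close> is repeated, nothing later exceeds \<open>a\<close>, hence every
  later entry is repeated as well and the rest is weakly decreasing. Counting weakly decreasing
  tails by binomial coefficients and summing over \<open>k\<close> gives a power of two.\<close>

section \<open>Occurrences of 0012 as subsequences\<close>

lemma card_below_less_iff:
  fixes A :: "'a::linorder set"
  assumes "finite A" "x \<in> A" "y \<in> A"
  shows "card {u \<in> A. u < x} < card {u \<in> A. u < y} \<longleftrightarrow> x < y"
proof
  assume "x < y"
  with assms have "{u \<in> A. u < x} \<subset> {u \<in> A. u < y}"
    by auto
  with assms show "card {u \<in> A. u < x} < card {u \<in> A. u < y}"
    by (intro psubset_card_mono) auto
next
  assume less: "card {u \<in> A. u < x} < card {u \<in> A. u < y}"
  show "x < y"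
  proof (rule ccontr)
    assume "\<not> x < y"
    with assms have "card {u \<in> A. u < y} \<le> card {u \<in> A. u < x}"
      by (intro card_mono) auto
    with less show False by simp
  qed
qed

text \<open>Ranks compare exactly as the entries themselves do, so every equality and inequality in
  the reduced word transfers back to \<open>s\<close>.\<close>

lemma reduction_eq_0012_iff:
  "reduction s = [0, 0, 1, 2] \<longleftrightarrow> (\<exists>a b c. s = [a, a, b, c] \<and> a < b \<and> b < c)"
proof
  assume red: "reduction s = [0, 0, 1, 2]"
  define rank where "rank = (\<lambda>x. card {y \<in> set s. y < x})"
  have map: "map rank s = [0, 0, 1, 2]"
    using red by (simp add: reduction_def rank_def)
  then obtain w x y z where s: "s = [w, x, y, z]"
    and ranks: "rank w = 0" "rank x = 0" "rank y = 1" "rank z = 2"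
    by (auto simp: map_eq_Cons_conv)
  have rank: "rank u < rank v \<longleftrightarrow> u < v" if "u \<in> set s" "v \<in> set s" for u v
    unfolding rank_def by (rule card_below_less_iff) (use that in auto)
  have "w = x" "x < y" "y < z"
    using rank[of w x] rank[of x w] rank[of x y] rank[of y z] ranks s by auto
  with s show "\<exists>a b c. s = [a, a, b, c] \<and> a < b \<and> b < c"
    by blast
next
  assume "\<exists>a b c. s = [a, a, b, c] \<and> a < b \<and> b < c"
  then obtain a b c where s: "s = [a, a, b, c]" and less: "a < b" "b < c"
    by blast
  have "{y \<in> set s. y < a} = {}" "{y \<in> set s. y < b} = {a}" "{y \<in> set s. y < c} = {a, b}"
    using s less by auto
  with s less show "reduction s = [0, 0, 1, 2]"
    by (simp add: reduction_def)
qed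

lemma set_subseq: "subseq xs ys \<Longrightarrow> set xs \<subseteq> set ys"
  by (metis notin_set_nthsI subseq_conv_nths subsetI)

text \<open>Puts sortedness into the language of patterns: with \<open><\<close> it forbids repeats
  in \<open>[0..<k]\<close>, with \<open>\<ge>\<close> it describes the tails.\<close>

lemma sorted_wrt_iff_subseq: "sorted_wrt P xs \<longleftrightarrow> (\<forall>x y. subseq [x, y] xs \<longrightarrow> P x y)"
proof (induction xs)
  case Nil
  show ?case by simp
next
  case (Cons z xs)
  have "subseq [x, y] (z # xs) \<longleftrightarrow> x = z \<and> y \<in> set xs \<or> subseq [x, y] xs" for x y
    using set_subseq[of "[x, y]" xs] by (auto simp: subseq_singleton_left)
  with Cons show ?case
    by auto
qed

lemma contains_0012_iff:
  "contains_pattern e [0, 0, 1, 2] \<longleftrightarrow> (\<exists>a b c. subseq [a, a, b, c] e \<and> a < b \<and> b < c)"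
  unfolding contains_pattern_def reduction_eq_0012_iff by blast

section \<open>Removing the maximal last entry\<close>

definition avoids_001 :: "nat list \<Rightarrow> bool" where
  "avoids_001 e \<longleftrightarrow> (\<forall>a b. subseq [a, a, b] e \<longrightarrow> b \<le> a)"

text \<open>Exceeding all of \<open>e\<close>, the entry \<open>m\<close> can serve as the 2 after
  any 001. Conversely, an occurrence of 0012 without its last letter is a 001 that lies within
  \<open>e\<close>.\<close>

lemma contains_0012_snoc_iff:
  assumes "\<forall>x \<in> set e. x < m"
  shows "contains_pattern (e @ [m]) [0, 0, 1, 2] \<longleftrightarrow> \<not> avoids_001 e"
proof
  assume "contains_pattern (e @ [m]) [0, 0, 1, 2]"
  then obtain a b c where sub: "subseq ([a, a, b] @ [c]) (e @ [m])" and less: "a < b"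
    by (auto simp: contains_0012_iff simp del: One_nat_def)
  have "subseq (butlast ([a, a, b] @ [c])) e"
  proof -
    obtain u v where uv: "[a, a, b] @ [c] = u @ v" "subseq u e" "subseq v [m]"
      using sub by (auto elim: subseq_appendE)
    \<comment> \<open>Only the part \<open>v\<close> can use the final \<open>m\<close>, so deleting
      the last letter leaves a subsequence of \<open>u\<close>, or \<open>u\<close> itself.\<close>
    have "length v \<le> 1"
      using uv(3) list_emb_length by fastforce
    with uv show ?thesis
      by (cases v) (auto simp: butlast_append intro: subseq_order.trans[OF _ uv(2)])
  qed
  with less show "\<not> avoids_001 e"
    by (auto simp: avoids_001_def not_le)
next
  assume "\<not> avoids_001 e"
  then obtain a b where sub: "subseq [a, a, b] e" and less: "a < b"
    by (auto simp: avoids_001_def not_le)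
  have "b \<in> set e"
    using set_subseq[OF sub] by simp
  moreover have "subseq ([a, a, b] @ [m]) (e @ [m])"
    using sub by (simp only: subseq_append)
  ultimately show "contains_pattern (e @ [m]) [0, 0, 1, 2]"
    using less assms unfolding contains_0012_iff by fastforce
qed

lemma inversion_sequence_snoc_iff:
  "inversion_sequence (Suc m) (e @ [x]) \<longleftrightarrow> inversion_sequence m e \<and> x \<le> m"
  by (auto simp: inversion_sequence_def nth_append less_Suc_eq)

lemma inversion_sequence_less:
  "inversion_sequence m e \<Longrightarrow> x \<in> set e \<Longrightarrow> x < m"
  by (auto simp: inversion_sequence_def in_set_conv_nth intro: le_less_trans)

lemma inversion_sequences_avoiding_0012_last_max:
  "{e \<in> inversion_sequences_avoiding (Suc m) [0, 0, 1, 2]. e ! m = m} =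
   (\<lambda>e. e @ [m]) ` {e. inversion_sequence m e \<and> avoids_001 e}" (is "?L = ?R")
proof (intro equalityI subsetI)
  fix e assume e: "e \<in> ?L"
  then have "length e = Suc m"
    by (simp add: inversion_sequences_avoiding_def inversion_sequence_def)
  then obtain e' x where "e = e' @ [x]" "length e' = m"
    by (metis length_Suc_conv_rev)
  moreover with e have "x = m"
    by auto
  ultimately show "e \<in> ?R"
    using e by (auto simp: inversion_sequences_avoiding_def inversion_sequence_snoc_iff
        contains_0012_snoc_iff inversion_sequence_less simp del: One_nat_def)
next
  fix e assume "e \<in> ?R"
  then show "e \<in> ?L"
    by (auto simp: inversion_sequences_avoiding_def inversion_sequence_snoc_iff
        contains_0012_snoc_iff inversion_sequence_less simp del: One_nat_def)
      (auto simp: inversion_sequence_def nth_append)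
qed

section \<open>Weakly decreasing tails\<close>

definition decreasing_tails :: "nat \<Rightarrow> nat \<Rightarrow> nat list set" where
  "decreasing_tails a r = {t. length t = r \<and> sorted_wrt (\<ge>) (a # t)}"

lemma decreasing_tails_0: "decreasing_tails a 0 = {[]}"
  by (auto simp: decreasing_tails_def)

lemma decreasing_tails_Suc:
  "decreasing_tails a (Suc r) = (\<Union>b\<le>a. (#) b ` decreasing_tails b r)"
  by (fastforce simp: decreasing_tails_def length_Suc_conv image_iff)

lemma finite_decreasing_tails: "finite (decreasing_tails a r)"
  by (induction r arbitrary: a) (simp_all add: decreasing_tails_0 decreasing_tails_Suc)

lemma card_UN_Cons:
  assumes "finite I" "\<And>a. a \<in> I \<Longrightarrow> finite (S a)"
  shows "card (\<Union>a\<in>I. (#) a ` S a) = (\<Sum>a\<in>I. card (S a))"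
  using assms by (subst card_UN_disjoint) (auto intro!: sum.cong card_image)

text \<open>Splitting by the first entry of the tail turns the induction step into the hockey-stick
  identity \<open>sum_choose_lower\<close>.\<close>

lemma card_decreasing_tails: "card (decreasing_tails a r) = (r + a) choose a"
proof (induction r arbitrary: a)
  case 0
  show ?case by (simp add: decreasing_tails_0)
next
  case (Suc r)
  then show ?case
    by (simp add: decreasing_tails_Suc card_UN_Cons finite_decreasing_tails sum_choose_lower)
qed

section \<open>Continuations of a prefix \<open>0, 1, ..., k - 1\<close>\<close>

definition avoiding_tails :: "nat \<Rightarrow> nat \<Rightarrow> nat list set" where
  "avoiding_tails k r =
     {t. inversion_sequence (k + r) ([0..<k] @ t) \<and> avoids_001 ([0..<k] @ t)}"

lemma not_subseq_repeat_upt: "\<not> subseq [c, c] [0..<k]"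
  using sorted_wrt_upt[of 0 k] by (auto simp: sorted_wrt_iff_subseq)

text \<open>Each value below \<open>k\<close> has a copy in the prefix, so an ascent from such a
  value in \<open>a # t\<close> completes a 001. Conversely, the prefix has no repeats, so the
  second \<open>c\<close> of an occurrence of \<open>[c, c, b]\<close> lies in
  \<open>a # t\<close>.\<close>

lemma avoids_001_upt_append_iff:
  assumes "a < k"
  shows "avoids_001 ([0..<k] @ a # t) \<longleftrightarrow> sorted_wrt (\<ge>) (a # t)"
proof
  assume avoids: "avoids_001 ([0..<k] @ a # t)"
  have le: "y \<le> x" if "x < k" "subseq [x, y] (a # t)" for x y
  proof -
    have "subseq [x] [0..<k]"
      using that by (simp add: subseq_singleton_left)
    from list_emb_append_mono[OF this that(2)] have "subseq [x, x, y] ([0..<k] @ a # t)"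
      by simp
    with avoids show ?thesis
      by (auto simp: avoids_001_def)
  qed
  \<comment> \<open>This keeps all later entries below \<open>k\<close>, so that \<open>le\<close>
    applies to them as well.\<close>
  have le_a: "y \<le> a" if "y \<in> set t" for y
    using le[of a y] assms that by (simp add: subseq_singleton_left)
  have "y \<le> x" if "subseq [x, y] t" for x y
  proof (rule le)
    have "x \<in> set t"
      using set_subseq[OF that] by simp
    with le_a assms show "x < k"
      by fastforce
    show "subseq [x, y] (a # t)"
      using that by (rule list_emb_Cons)
  qed
  then have "sorted_wrt (\<ge>) t"
    by (simp add: sorted_wrt_iff_subseq)
  with le_a show "sorted_wrt (\<ge>) (a # t)"
    by simp
next
  assume sorted: "sorted_wrt (\<ge>) (a # t)"
  have "c \<ge> b" if "subseq [c, c, b] ([0..<k] @ a # t)" for b c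
  proof -
    obtain u v where uv: "[c, c, b] = u @ v" "subseq u [0..<k]" "subseq v (a # t)"
      using \<open>subseq [c, c, b] _\<close> by (auto elim: subseq_appendE)
    \<comment> \<open>Hence \<open>u\<close> has at most one letter, and \<open>v\<close> still
      contains \<open>[c, b]\<close>.\<close>
    have "\<not> subseq (c # c # w) [0..<k]" for w
      using not_subseq_repeat_upt[of c k] subseq_order.trans[of "[c, c]" "c # c # w"] by auto
    with uv have "subseq [c, b] (a # t)"
      by (auto simp: Cons_eq_append_conv dest: subseq_Cons' split: if_splits)
    with sorted show ?thesis
      by (simp only: sorted_wrt_iff_subseq)
  qed
  then show "avoids_001 ([0..<k] @ a # t)"
    by (simp add: avoids_001_def)
qed

lemma avoiding_tails_0: "avoiding_tails k 0 = {[]}"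
proof -
  have "\<not> subseq [c, c, b] [0..<k]" for b c
    using not_subseq_repeat_upt[of c k] subseq_order.trans[of "[c, c]" "[c, c, b]"] by auto
  then show ?thesis
    by (auto simp: avoiding_tails_def inversion_sequence_def avoids_001_def)
qed

lemma inversion_sequence_upt_append_iff:
  "inversion_sequence (k + r) ([0..<k] @ t) \<longleftrightarrow> length t = r \<and> (\<forall>i<r. t ! i \<le> k + i)"
proof -
  have "(\<forall>i<k + r. ([0..<k] @ t) ! i \<le> i) \<longleftrightarrow> (\<forall>i<r. t ! i \<le> k + i)"
  proof (intro iffI allI impI)
    fix i assume "\<forall>i<k + r. ([0..<k] @ t) ! i \<le> i" "i < r"
    then show "t ! i \<le> k + i"
      by (auto dest: spec[of _ "k + i"] simp: nth_append)
  next
    fix i assume "\<forall>i<r. t ! i \<le> k + i" "i < k + r"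
    then show "([0..<k] @ t) ! i \<le> i"
      by (auto dest: spec[of _ "i - k"] simp: nth_append)
  qed
  then show ?thesis
    by (auto simp: inversion_sequence_def)
qed

text \<open>The inversion bound is automatic here, since no entry of the decreasing tail exceeds
  \<open>a < k\<close>.\<close>

lemma avoiding_tails_Cons_less:
  assumes "a < k"
  shows "a # t \<in> avoiding_tails k (Suc r) \<longleftrightarrow> t \<in> decreasing_tails a r"
proof -
  have "(a # t) ! i \<le> k + i"
    if "sorted_wrt (\<ge>) (a # t)" "length t = r" "i < Suc r" for i
  proof -
    have "(a # t) ! i \<in> set (a # t)"
      using that by (intro nth_mem) simp
    with that assms show ?thesis
      by fastforce
  qed
  then show ?thesis
    unfolding avoiding_tails_def decreasing_tails_def
    using assms by (auto simp only: avoids_001_upt_append_iff inversion_sequence_upt_append_iff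
        mem_Collect_eq list.size)
qed

lemma avoiding_tails_Cons_eq:
  "k # t \<in> avoiding_tails k (Suc r) \<longleftrightarrow> t \<in> avoiding_tails (Suc k) r"
  by (simp add: avoiding_tails_def)

text \<open>The first entry is at most \<open>k\<close>. If it equals \<open>k\<close>, it is
  absorbed into the prefix; if it is smaller, the rest must decrease weakly.\<close>

lemma avoiding_tails_Suc:
  "avoiding_tails k (Suc r) =
   (#) k ` avoiding_tails (Suc k) r \<union> (\<Union>a<k. (#) a ` decreasing_tails a r)" (is "?L = ?R")
proof (rule set_eqI)
  fix t
  have length: "length t = Suc r" and hd: "t ! 0 \<le> k" if "t \<in> ?L"
    using that unfolding avoiding_tails_def inversion_sequence_upt_append_iff by auto
  show "t \<in> ?L \<longleftrightarrow> t \<in> ?R"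
  proof (cases t)
    case Nil
    then show ?thesis
      using length by auto
  next
    case (Cons a t')
    consider "a < k" | "a = k" | "a > k"
      by linarith
    then show ?thesis
      using Cons hd by cases (auto simp: avoiding_tails_Cons_less avoiding_tails_Cons_eq)
  qed
qed

lemma finite_avoiding_tails: "finite (avoiding_tails k r)"
  by (induction r arbitrary: k)
    (simp_all add: avoiding_tails_0 avoiding_tails_Suc finite_decreasing_tails)

lemma card_avoiding_tails_Suc:
  "card (avoiding_tails k (Suc r)) =
   card (avoiding_tails (Suc k) r) + (\<Sum>a<k. card (decreasing_tails a r))"
  unfolding avoiding_tails_Suc
  by (subst card_Un_disjoint)
    (auto simp: finite_avoiding_tails finite_decreasing_tails card_UN_Cons card_image)

text \<open>The recursion raises \<open>j\<close> and lowers \<open>r\<close>, so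
  \<open>j + r\<close> is fixed and each step adds the next term of one row of Pascal's
  triangle.\<close>

lemma card_avoiding_tails:
  "card (avoiding_tails (Suc j) r) = (\<Sum>i\<le>r. (j + r) choose i)"
proof (induction r arbitrary: j)
  case 0
  show ?case by (simp add: avoiding_tails_0)
next
  case (Suc r)
  have "(\<Sum>a<Suc j. card (decreasing_tails a r)) = Suc (r + j) choose j"
    by (simp add: card_decreasing_tails lessThan_Suc_atMost sum_choose_lower del: sum.lessThan_Suc)
  \<comment> \<open>Symmetry gives the term that extends the partial row sum from \<open>r\<close>
    to \<open>Suc r\<close>.\<close>
  also have "\<dots> = (j + Suc r) choose Suc r"
    using binomial_symmetric[of j "Suc (r + j)"] by (simp add: add.commute)
  finally show ?case
    unfolding card_avoiding_tails_Suc Suc.IH by simp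
qed

theorem theorem1p3:
  fixes n :: nat
  assumes "n \<ge> 1"
  shows "card {e \<in> inversion_sequences_avoiding n [0, 0, 1, 2]. e ! (n - 1) = n - 1}
           = (if n = 1 then 1 else 2 ^ (n - 2))"
proof -
  obtain m where n: "n = Suc m"
    using assms by (cases n) auto
  \<comment> \<open>The prefix \<open>[0..<0]\<close> is empty, so \<open>avoiding_tails 0 m\<close>
    holds all 001-avoiding inversion sequences of length \<open>m\<close>.\<close>
  have "card {e \<in> inversion_sequences_avoiding n [0, 0, 1, 2]. e ! (n - 1) = n - 1} =
        card (avoiding_tails 0 m)"
    by (simp add: n inversion_sequences_avoiding_0012_last_max avoiding_tails_def
        card_image inj_on_def del: One_nat_def)
  also have "\<dots> = (if n = 1 then 1 else 2 ^ (n - 2))"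
  proof (cases m)
    case 0
    then show ?thesis by (simp add: n avoiding_tails_0)
  next
    \<comment> \<open>For \<open>k = 0\<close> the sum over \<open>a < k\<close> is empty: the first
      entry must be 0. Then \<open>j = 0\<close> gives the full row \<open>r\<close>, with sum
      \<open>2 ^ r\<close> and \<open>r = n - 2\<close>.\<close>
    case (Suc r)
    then show ?thesis
      by (simp add: n card_avoiding_tails_Suc card_avoiding_tails choose_row_sum)
  qed
  finally show ?thesis .
qed

end
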